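(* Let $1\le k\le n$, let $f$ be a real-valued differentiable function on a neighborhood $\mathrm{St}_\delta(k,n)$ of $\mathrm{St}(k,n)$ with Euclidean gradient $\mathcal{H}(P)=\partial f(P)/\partial P$, and suppose that the NPDo Ansatz holds for $f$ with a subset $\mathbb{P}\subseteq\mathrm{St}(k,n)$. Let the sequence $\{P^{(i)}\}_{i=0}^\infty$ be generated by Algorithm NPDoSCF (described in the context) from some $P^{(0)}\in\mathbb{P}$. Then: (a) The sequence $\{f(P^{(i)})\}_{i=0}^\infty$ is monotonically increasing (i.e. nondecreasing) and convergent. (b) Any accumulation point $P_*$ of the sequence $\{P^{(i)}\}_{i=0}^\infty$ satisfies the following necessary conditions for a global maximizer of $f$ over $\mathrm{St}(k,n)$: $\mathcal{H}(P_* )=P_*\Lambda_*$ with $\Lambda_*=P_*^{\mathrm T}\mathcal{H}(P_* )\succeq 0$. (c) The following two series converge: $$\sum_{i=1}^\infty \sigma_{\min}(\mathcal{H}(P^{(i)}))\,\big\|\sin\Theta\big(\mathcal{R}(P^{(i+1)}),\mathcal{R}(P^{(i)})\big)\big\|_{\mathrm F}^2<\infty,$$ $$\sum_{i=1}^\infty \sigma_{\min}(\mathcal{H}(P^{(i)}))\,\frac{\big\|\mathcal{H}(P^{(i)})-P^{(i)}\big([P^{(i)}]^{\mathrm T}\mathcal{H}(P^{(i)})\big)\big\|_{\mathrm F}^2}{\big\|\mathcal{H}(P^{(i)})\big\|_{\mathrm F}^2}<\infty .$$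
   Context: $\mathrm{St}(k,n)=\{P\in\mathbb{R}^{n\times k}: P^{\mathrm T}P=I_k\}$; $\mathrm{St}_\delta(k,n)=\{P\in\mathbb{R}^{n\times k}:\|P^{\mathrm T}P-I_k\|<\delta\}$ for some constant $\delta>0$ and some matrix norm. $\partial f(P)/\partial P$ is the $n\times k$ matrix of partial derivatives with all entries of $P$ treated as independent. $A\succeq0$ means symmetric positive semidefinite; $\mathcal{R}(B)$ is the column space of $B$; $\sigma_{\min}(B)$ is the smallest of the $\min\{n,k\}=k$ singular values of $B\in\mathbb{R}^{n\times k}$; $\|\cdot\|_{\mathrm F}$ is the Frobenius norm. Canonical angles: for $X,Y\in\mathrm{St}(k,n)$, $\Theta(\mathcal{R}(X),\mathcal{R}(Y))$ is the diagonal matrix of the angles $\theta_i=\arccos\sigma_i(X^{\mathrm T}Y)\in[0,\pi/2]$, $1\le i\le k$, where $\sigma_i(\cdot)$ denotes singular values, and $\|\sin\Theta\|_{\mathrm F}=(\sum_i\sin^2\theta_i)^{1/2}$. NPDo Ansatz (for $f$ with $\mathbb{P}$): there is a constant $\omega>0$ (independent of $P,\widehat P$) such that whenever $P\in\mathbb{P}$, $\widehat P\in\mathrm{St}(k,n)$ and $\eta\in\mathbb{R}$ satisfy $\mathrm{tr}(\widehat P^{\mathrm T}\mathcal{H}(P))\ge \mathrm{tr}(P^{\mathrm T}\mathcal{H}(P))+\eta$, there exists $Q\in\mathrm{St}(k,k)$ such that $\widetilde P=\widehat PQ\in\mathbb{P}$ and $f(\widetilde P)\ge f(P)+\omega\eta$.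 Algorithm NPDoSCF: given $P^{(0)}\in\mathbb{P}$, for $i=0,1,2,\dots$ (run indefinitely): compute a thin SVD $\mathcal{H}(P^{(i)})=U_i\Sigma_iV_i^{\mathrm T}$ with $U_i\in\mathrm{St}(k,n)$, $V_i\in\mathrm{St}(k,k)$; set $\widehat P^{(i)}=U_iV_i^{\mathrm T}\in\mathrm{St}(k,n)$, an orthonormal polar factor of $\mathcal{H}(P^{(i)})$; take $Q_i\in\mathrm{St}(k,k)$ as supplied by the NPDo Ansatz for $P=P^{(i)}$, $\widehat P=\widehat P^{(i)}$ and $\eta=\eta_i:=\mathrm{tr}([\widehat P^{(i)}]^{\mathrm T}\mathcal{H}(P^{(i)}))-\mathrm{tr}([P^{(i)}]^{\mathrm T}\mathcal{H}(P^{(i)}))$, i.e. such that $P^{(i+1)}:=\widehat P^{(i)}Q_i\in\mathbb{P}$ and $f(P^{(i+1)})\ge f(P^{(i)})+\omega\eta_i$.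
   Formalization: Part (b) is proved under the additional assumption that the gradient H is continuous on St(k,n); with f merely differentiable, (b) is false (already for k=1, n=2). Parts (a) and (c) are as stated. *)

theory Defs
  imports "HOL-Analysis.Analysis"
begin

(* An n x k real matrix is an element of real^'k^'n, with n = CARD('n) and k = CARD('k).
   The library's norm on this type is the Euclidean norm of all entries, that is, the
   Frobenius norm. *)

definition stiefel :: "(real^'k^'n) set" where
  "stiefel = {P. transpose P ** P = mat 1}"

definition matrix_norm :: "(real^'k^'k \<Rightarrow> real) \<Rightarrow> bool" where
  "matrix_norm N \<longleftrightarrow>
     (\<forall>A. N A \<ge> 0) \<and> (\<forall>A. N A = 0 \<longleftrightarrow> A = 0) \<and>
     (\<forall>c A. N (c *\<^sub>R A) = \<bar>c\<bar> * N A) \<and> (\<forall>A B. N (A + B) \<le> N A + N B)"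

definition stiefel_nbhd :: "(real^'k^'k \<Rightarrow> real) \<Rightarrow> real \<Rightarrow> (real^'k^'n) set" where
  "stiefel_nbhd N \<delta> = {P. N (transpose P ** P - mat 1) < \<delta>}"

(* axis i (axis j 1) is the matrix with entry 1 at (i, j) and 0 elsewhere. *)
definition euclid_grad :: "(real^'k^'n \<Rightarrow> real) \<Rightarrow> real^'k^'n \<Rightarrow> real^'k^'n" where
  "euclid_grad f P = (\<chi> i j. deriv (\<lambda>t. f (P + t *\<^sub>R axis i (axis j 1))) 0)"

definition psd :: "real^'k^'k \<Rightarrow> bool" where
  "psd A \<longleftrightarrow> transpose A = A \<and> (\<forall>x. x \<bullet> (A *v x) \<ge> 0)"

definition diag_matrix :: "real^'k \<Rightarrow> real^'k^'k" where
  "diag_matrix s = (\<chi> i j. if i = j then s $ i else 0)"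

definition thin_svd ::
  "real^'k^'n \<Rightarrow> real^'k^'n \<Rightarrow> real^'k \<Rightarrow> real^'k^'k \<Rightarrow> bool" where
  "thin_svd B U s V \<longleftrightarrow>
     U \<in> stiefel \<and> V \<in> stiefel \<and> (\<forall>i. s $ i \<ge> 0) \<and>
     B = U ** diag_matrix s ** transpose V"

(* The k singular values, with multiplicity, of an n x k matrix with k <= n. Such a matrix has
   a thin SVD, whose diagonal is unique up to a permutation of its entries; only
   permutation-invariant functions of sing_vals are used. *)
definition sing_vals :: "real^'k^'n \<Rightarrow> real^'k" where
  "sing_vals B = (SOME s. \<exists>U V. thin_svd B U s V)"

definition sigma_min :: "real^'k^'n \<Rightarrow> real" where
  "sigma_min B = Min (range (\<lambda>i. sing_vals B $ i))"

(* For X, Y in stiefel this depends, up to a permutation of the angles, only on the column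
   spaces of X and Y: it represents the canonical angles between these subspaces. *)
definition canonical_angles :: "real^'k^'n \<Rightarrow> real^'k^'n \<Rightarrow> real^'k" where
  "canonical_angles X Y = (\<chi> i. arccos (sing_vals (transpose X ** Y) $ i))"

definition sin_Theta :: "real^'k^'n \<Rightarrow> real^'k^'n \<Rightarrow> real^'k^'k" where
  "sin_Theta X Y = diag_matrix (\<chi> i. sin (canonical_angles X Y $ i))"

definition npdo_ansatz ::
  "(real^'k^'n \<Rightarrow> real) \<Rightarrow> (real^'k^'n) set \<Rightarrow> real \<Rightarrow> bool" where
  "npdo_ansatz f PP \<omega> \<longleftrightarrow>
     \<omega> > 0 \<and>
     (\<forall>P\<in>PP. \<forall>Phat\<in>stiefel. \<forall>\<eta>.
        trace (transpose Phat ** euclid_grad f P) \<ge> trace (transpose P ** euclid_grad f P) + \<eta> \<longrightarrow>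
        (\<exists>Q::real^'k^'k. Q \<in> stiefel \<and> Phat ** Q \<in> PP \<and> f (Phat ** Q) \<ge> f P + \<omega> * \<eta>))"

(* The algorithm is nondeterministic: neither the thin SVD nor Q is unique, and any admissible
   choice may be made at each step. *)
definition npdo_scf ::
  "(real^'k^'n \<Rightarrow> real) \<Rightarrow> (real^'k^'n) set \<Rightarrow> real \<Rightarrow> (nat \<Rightarrow> real^'k^'n) \<Rightarrow> bool" where
  "npdo_scf f PP \<omega> P \<longleftrightarrow>
     P 0 \<in> PP \<and>
     (\<forall>i. \<exists>U s V Phat \<eta>. \<exists>Q::real^'k^'k.
        thin_svd (euclid_grad f (P i)) U s V \<and>
        Phat = U ** transpose V \<and>
        \<eta> = trace (transpose Phat ** euclid_grad f (P i))
              - trace (transpose (P i) ** euclid_grad f (P i)) \<and>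
        Q \<in> stiefel \<and>
        P (Suc i) = Phat ** Q \<and> P (Suc i) \<in> PP \<and>
        f (P (Suc i)) \<ge> f (P i) + \<omega> * \<eta>)"

definition accumulation_point :: "(nat \<Rightarrow> 'a::topological_space) \<Rightarrow> 'a \<Rightarrow> bool" where
  "accumulation_point X x \<longleftrightarrow> (\<exists>r. strict_mono r \<and> (X \<circ> r) \<longlonglongrightarrow> x)"

end

theory Submission
  imports Defs
begin

text \<open>
  Write \<open>H = U \<Sigma> V\<^sup>T\<close> for the gradient at \<open>P\<close> and \<open>W = U\<^sup>T P V\<close>. The gain
  \<open>\<eta> = tr((U V\<^sup>T)\<^sup>T H) - tr(P\<^sup>T H)\<close> of one step equals \<open>\<Sum>\<^sub>j \<sigma>\<^sub>j (1 - W\<^sub>j\<^sub>j)\<close>. It is nonnegative since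
  \<open>\<bar>W\<^sub>j\<^sub>j\<bar> \<le> 1\<close>, and summable since \<open>f\<close> is bounded on the compact Stiefel manifold. As
  \<open>\<parallel>sin \<Theta>\<parallel>\<^sup>2 = k - \<parallel>W\<parallel>\<^sup>2 \<le> \<Sum>\<^sub>j (1 - W\<^sub>j\<^sub>j\<^sup>2) \<le> 2 \<Sum>\<^sub>j (1 - W\<^sub>j\<^sub>j)\<close> and \<open>\<sigma>\<^sub>m\<^sub>i\<^sub>n \<le> \<sigma>\<^sub>j\<close>,
  the terms of the first series are at most \<open>2 \<eta>\<close>; they dominate those of the second one because \<open>H = U V\<^sup>T M\<close> with
  \<open>\<parallel>M\<parallel> = \<parallel>H\<parallel>\<close>. Since \<open>U V\<^sup>T\<close> maximizes \<open>X \<mapsto> tr(X\<^sup>T H)\<close> and \<open>\<eta> \<rightarrow> 0\<close>, an accumulation point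
  \<open>P\<^sub>*\<close> maximizes \<open>X \<mapsto> tr(X\<^sup>T H(P\<^sub>*))\<close>; comparing it with \<open>P\<^sub>* R\<close> and \<open>R P\<^sub>*\<close> for products \<open>R\<close> of
  at most two reflections shows that \<open>P\<^sub>*\<^sup>T H(P\<^sub>*)\<close> and \<open>H(P\<^sub>*) P\<^sub>*\<^sup>T\<close> are positive semidefinite.
\<close>

section \<open>Algebra of the matrix product and the Frobenius inner product\<close>

lemma bounded_bilinear_matrix_mult:
  "bounded_bilinear ((**) :: real^'m^'n \<Rightarrow> real^'k^'m \<Rightarrow> real^'k^'n)"
  unfolding bilinear_conv_bounded_bilinear [symmetric] bilinear_def
  by (intro conjI allI linearI)
    (simp_all add: matrix_matrix_mult_def vec_eq_iff sum.distrib sum_distrib_left algebra_simps)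

interpretation matrix_mult:
  bounded_bilinear "(**) :: real^'m^'n \<Rightarrow> real^'k^'m \<Rightarrow> real^'k^'n"
  by (rule bounded_bilinear_matrix_mult)

lemma bounded_linear_transpose: "bounded_linear (transpose :: real^'k^'n \<Rightarrow> real^'n^'k)"
  unfolding linear_conv_bounded_linear [symmetric]
  by (rule linearI) (simp_all add: transpose_def vec_eq_iff)

lemmas transpose_diff = linear_diff[OF bounded_linear.linear[OF bounded_linear_transpose]]
lemmas transpose_scaleR = linear_scale[OF bounded_linear.linear[OF bounded_linear_transpose]]
lemmas continuous_on_transpose = bounded_linear.continuous_on[OF bounded_linear_transpose]

text \<open>Links the traces in the Ansatz and in the algorithm to the library inner product, so
  that norms, adjoints and limits can be treated with inner product facts.\<close>

lemma inner_eq_trace: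
  fixes A B :: "real^'k^'n"
  shows "A \<bullet> B = trace (transpose A ** B)"
proof -
  have "A \<bullet> B = (\<Sum>i\<in>UNIV. \<Sum>j\<in>UNIV. A$i$j * B$i$j)"
    by (simp add: inner_vec_def)
  also have "\<dots> = (\<Sum>j\<in>UNIV. \<Sum>i\<in>UNIV. A$i$j * B$i$j)"
    by (rule sum.swap)
  finally show ?thesis
    by (simp add: trace_def matrix_matrix_mult_def transpose_def)
qed

lemma inner_mult_left:
  fixes A :: "real^'k^'n" and B :: "real^'m^'n" and C :: "real^'k^'m"
  shows "A \<bullet> (B ** C) = (transpose B ** A) \<bullet> C"
  by (simp add: inner_eq_trace matrix_transpose_mul matrix_mul_assoc)

lemma inner_transpose:
  fixes A B :: "real^'k^'n"
  shows "transpose A \<bullet> transpose B = A \<bullet> B"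
  by (metis inner_eq_trace inner_commute trace_mul_sym transpose_transpose)

lemma inner_mult_right:
  fixes A :: "real^'k^'n" and B :: "real^'m^'n" and C :: "real^'k^'m"
  shows "A \<bullet> (B ** C) = (A ** transpose C) \<bullet> B"
  by (metis inner_eq_trace inner_commute matrix_mul_assoc matrix_transpose_mul trace_mul_sym)

lemma norm_transpose: "norm (transpose A) = norm (A :: real^'k^'n)"
  by (simp add: norm_eq_sqrt_inner inner_transpose)

section \<open>Reflections and a trace criterion for positive semidefiniteness\<close>

definition outer :: "real^'n \<Rightarrow> real^'m \<Rightarrow> real^'m^'n" where
  "outer x y = (\<chi> i j. x $ i * y $ j)"

lemma transpose_outer: "transpose (outer x y) = outer y x"
  by (simp add: outer_def transpose_def vec_eq_iff)

lemma outer_mult_outer: "outer x y ** outer w z = (y \<bullet> w) *\<^sub>R outer x z"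
  by (simp add: outer_def matrix_matrix_mult_def vec_eq_iff inner_vec_def sum_distrib_left
      sum_distrib_right algebra_simps)

lemma trace_mult_outer: "trace (B ** outer x y) = y \<bullet> (B *v x)"
  by (simp add: outer_def matrix_matrix_mult_def trace_def inner_vec_def matrix_vector_mult_def
      sum_distrib_left sum_distrib_right algebra_simps)

lemma trace_scaleR: "trace (c *\<^sub>R A) = c * trace (A :: real^'n^'n)"
  by (simp add: trace_def sum_distrib_left)

text \<open>At x = 0 this is the identity matrix, so \<open>reflection_in_stiefel\<close> covers
  every x.\<close>

definition reflection :: "real^'n \<Rightarrow> real^'n^'n" where
  "reflection x = mat 1 - (2 / (x \<bullet> x)) *\<^sub>R outer x x"

lemma reflection_in_stiefel: "reflection x \<in> stiefel"
proof -
  define c where "c = 2 / (x \<bullet> x)"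
  have "transpose (reflection x) ** reflection x = reflection x ** reflection x"
    by (simp add: reflection_def transpose_diff transpose_scaleR transpose_outer transpose_mat)
  also have "\<dots> = mat 1 + (c * (c * (x \<bullet> x)) - 2 * c) *\<^sub>R outer x x"
    by (simp add: reflection_def c_def [symmetric] matrix_mult.diff_left matrix_mult.diff_right
        matrix_mult.scaleR_left matrix_mult.scaleR_right outer_mult_outer vec_eq_iff algebra_simps)
  also have "c * (c * (x \<bullet> x)) - 2 * c = 0"
    by (simp add: c_def)
  finally show ?thesis
    by (simp add: stiefel_def)
qed

lemma stiefel_mult:
  "A \<in> stiefel \<Longrightarrow> B \<in> stiefel \<Longrightarrow> A ** B \<in> (stiefel :: (real^'k^'n) set)"
  for A :: "real^'m^'n" and B :: "real^'k^'m"
  by (simp add: stiefel_def matrix_transpose_mul)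
    (metis matrix_mul_assoc matrix_mul_lid)

lemma transpose_in_stiefel: "Q \<in> stiefel \<Longrightarrow> transpose Q \<in> stiefel" for Q :: "real^'k^'k"
  by (simp add: stiefel_def matrix_left_right_inverse)

text \<open>A single reflection along x changes the trace by a negative multiple of the quadratic
  form of B at x. Two reflections compose to a plane rotation, whose first-order effect on the trace
  is the skew part of B; at a maximum it must vanish.\<close>

lemma psd_if_trace_maximal:
  fixes B :: "real^'n^'n"
  assumes max: "\<And>R. R \<in> stiefel \<Longrightarrow> trace (B ** R) \<le> trace B"
  shows "psd B"
proof -
  have nonneg: "x \<bullet> (B *v x) \<ge> 0" for x
    using max[OF reflection_in_stiefel[of x]]
    by (cases "x = 0") (auto simp: reflection_def matrix_mult.diff_right matrix_mult.scaleR_right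
        trace_sub trace_scaleR trace_mult_outer zero_le_divide_iff zero_le_mult_iff
        dest: leD split: if_splits)
  have sym: "x \<bullet> (B *v z) = z \<bullet> (B *v x)" if orth: "x \<bullet> x = 1" "z \<bullet> z = 1" "x \<bullet> z = 0" for x z
  proof -
    define a b where "a = x \<bullet> (B *v x) + z \<bullet> (B *v z)"
      and "b = x \<bullet> (B *v z) - z \<bullet> (B *v x)"
    \<comment> \<open>Reflect along x and along the nearby vector y = x + t z. Clearing the
      denominator 1 + t^2 in the trace inequality leaves a quadratic in t without constant
      term.\<close>
    have quad: "0 \<le> a * t\<^sup>2 + b * t" for t
    proof -
      define y where "y = x + t *\<^sub>R z"
      define c where "c = 1 + t\<^sup>2"
      have xy: "x \<bullet> y = 1" and yy: "y \<bullet> y = c"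
        using orth by (simp_all add: y_def c_def inner_add inner_commute power2_eq_square)
      have "c > 0"
        unfolding c_def by (metis add_pos_nonneg zero_le_power2 zero_less_one)
      have "trace (B ** (reflection x ** reflection y)) \<le> trace B"
        by (intro max stiefel_mult reflection_in_stiefel)
      also have "trace (B ** (reflection x ** reflection y)) = trace B - 2 * (x \<bullet> (B *v x))
          - 2 / c * (y \<bullet> (B *v y)) + 4 / c * (y \<bullet> (B *v x))"
        by (simp add: reflection_def matrix_mult.diff_left matrix_mult.diff_right
            matrix_mult.scaleR_left matrix_mult.scaleR_right outer_mult_outer orth xy yy
            trace_sub trace_scaleR trace_mult_outer diff_divide_distrib)
      finally have "2 * (y \<bullet> (B *v x)) \<le> c * (x \<bullet> (B *v x)) + y \<bullet> (B *v y)"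
        using \<open>c > 0\<close> by (simp add: field_simps)
      then show ?thesis
        by (simp add: y_def a_def b_def c_def algebra_simps inner_add power2_eq_square
            matrix_vector_mult_scaleR matrix_vector_right_distrib)
    qed
    have "b = 0"
    proof (rule ccontr)
      assume "b \<noteq> 0"
      \<comment> \<open>Replacing a by c = |a| + 1 makes the leading coefficient positive; t = -b /
        (2c) is then the minimizer of c t^2 + b t.\<close>
      define c where "c = \<bar>a\<bar> + 1"
      have "c > 0" by (simp add: c_def)
      have "0 \<le> a * (- b / (2*c))\<^sup>2 + b * (- b / (2*c))"
        by (rule quad)
      also have "\<dots> \<le> c * (- b / (2*c))\<^sup>2 + b * (- b / (2*c))"
        by (intro add_right_mono mult_right_mono) (auto simp: c_def)
      also have "\<dots> = - b\<^sup>2 / (4*c)"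
        using \<open>c > 0\<close> by (simp add: field_simps power2_eq_square)
      also have "\<dots> < 0"
        using \<open>c > 0\<close> \<open>b \<noteq> 0\<close> by (simp add: divide_neg_pos)
      finally show False by simp
    qed
    then show ?thesis by (simp add: b_def)
  qed
  have entry: "axis i 1 \<bullet> (B *v axis j 1) = B $ i $ j" for i j
    by (simp add: matrix_vector_mult_basis inner_axis' column_def)
  have "B $ i $ j = B $ j $ i" for i j
    using sym[of "axis i 1" "axis j 1"]
    by (cases "i = j") (simp_all add: entry inner_axis_axis)
  then have "transpose B = B"
    by (simp add: transpose_def vec_eq_iff)
  with nonneg show ?thesis
    by (simp add: psd_def)
qed

section \<open>Compactness of the Stiefel manifold\<close>

lemma norm_stiefel: "X \<in> stiefel \<Longrightarrow> (norm X)\<^sup>2 = CARD('k)" for X :: "real^'k^'n"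
  by (simp add: power2_norm_eq_inner inner_eq_trace stiefel_def trace_I)

lemma compact_stiefel: "compact (stiefel :: (real^'k^'n) set)"
  unfolding compact_eq_bounded_closed
proof
  show "bounded (stiefel :: (real^'k^'n) set)"
    unfolding bounded_iff
    by (rule exI[of _ "sqrt (CARD('k))"]) (auto simp: real_le_rsqrt norm_stiefel)
  have "continuous_on UNIV (\<lambda>X :: real^'k^'n. transpose X ** X)"
    by (intro matrix_mult.continuous_on continuous_on_transpose continuous_on_id)
  then show "closed (stiefel :: (real^'k^'n) set)"
    unfolding stiefel_def by (intro closed_Collect_eq) auto
qed

lemma stiefel_nonempty:
  assumes "CARD('k) \<le> CARD('n)"
  shows "(stiefel :: (real^'k^'n) set) \<noteq> {}"
proof -
  obtain g :: "'k \<Rightarrow> 'n" where g: "inj g"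
    using assms card_le_inj[of "UNIV :: 'k set" "UNIV :: 'n set"] by auto
  \<comment> \<open>Column j is the basis vector with index g j; injectivity of g makes the columns
    orthonormal.\<close>
  have "(\<chi> i j. if i = g j then 1 else 0) \<in> (stiefel :: (real^'k^'n) set)"
    using inj_eq[OF g]
    by (simp add: stiefel_def transpose_def matrix_matrix_mult_def vec_eq_iff mat_def if_distrib
        if_distribR cong: if_cong)
  then show ?thesis by blast
qed

section \<open>Diagonal matrices and existence of the thin SVD\<close>

lemma mult_diag_matrix: "(A ** diag_matrix s) $ i $ j = A $ i $ j * s $ j"
  by (simp add: matrix_matrix_mult_def diag_matrix_def if_distrib cong: if_cong)

lemma diag_matrix_mult: "(diag_matrix s ** A) $ i $ j = s $ i * A $ i $ j"
  by (simp add: matrix_matrix_mult_def diag_matrix_def if_distribR if_distrib cong: if_cong)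

lemma transpose_diag_matrix [simp]: "transpose (diag_matrix s) = diag_matrix s"
  by (auto simp: diag_matrix_def transpose_def vec_eq_iff)

lemma norm_diag_matrix: "(norm (diag_matrix s))\<^sup>2 = (\<Sum>j\<in>UNIV. (s $ j)\<^sup>2)"
  unfolding power2_norm_eq_inner inner_vec_def diag_matrix_def
  by (simp add: if_distrib if_distribR power2_eq_square cong: if_cong)

text \<open>
  For a diagonal \<open>D\<close> with distinct positive entries, maximize \<open>(U, V) \<mapsto> tr((U D)\<^sup>T A V)\<close>. At a maximum,
  \<open>M = U\<^sup>T A V\<close> satisfies \<open>D M = M\<^sup>T D\<close> and \<open>M D = D M\<^sup>T\<close>, which forces \<open>M\<close> to be diagonal.
\<close>
lemma thin_svd_exists:
  fixes A :: "real^'k^'n"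
  assumes "CARD('k) \<le> CARD('n)"
  shows "\<exists>U s V. thin_svd A U s V"
proof -
  obtain g :: "'k \<Rightarrow> nat" where g: "inj g"
    using finite_imp_inj_to_nat_seg[of "UNIV :: 'k set"] by auto
  define d :: "real^'k" where "d = (\<chi> j. real (g j) + 1)"
  define D where "D = diag_matrix d"
  have d_pos: "d $ j > 0" for j by (simp add: d_def)
  have d_inj: "d $ i = d $ j \<Longrightarrow> i = j" for i j
    using inj_eq[OF g] by (simp add: d_def)
  have DT: "transpose D = D" by (simp add: D_def)
  have "continuous_on (stiefel \<times> stiefel)
      (\<lambda>(U :: real^'k^'n, V :: real^'k^'k). (U ** D) \<bullet> (A ** V))"
    unfolding case_prod_beta
    by (intro continuous_on_inner matrix_mult.continuous_on continuous_intros)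
  moreover have "compact ((stiefel :: (real^'k^'n) set) \<times> (stiefel :: (real^'k^'k) set))"
    by (intro compact_Times compact_stiefel)
  moreover have "(stiefel :: (real^'k^'n) set) \<times> (stiefel :: (real^'k^'k) set) \<noteq> {}"
    using stiefel_nonempty[OF assms] stiefel_nonempty[where 'k = 'k and 'n = 'k] by auto
  ultimately obtain U :: "real^'k^'n" and V :: "real^'k^'k"
    where U: "U \<in> stiefel" and V: "V \<in> stiefel"
      and max: "\<And>U' V'. U' \<in> stiefel \<Longrightarrow> V' \<in> stiefel \<Longrightarrow> (U' ** D) \<bullet> (A ** V') \<le> (U ** D) \<bullet> (A ** V)"
    using continuous_attains_sup[of "stiefel \<times> stiefel"] by fastforce
  define M where "M = transpose U ** A ** V"
  have right: "psd (D ** M)"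
  proof (rule psd_if_trace_maximal)
    fix R :: "real^'k^'k" assume "R \<in> stiefel"
    then have "(U ** D) \<bullet> (A ** (V ** R)) \<le> (U ** D) \<bullet> (A ** V)"
      by (intro max U stiefel_mult V)
    then show "trace (D ** M ** R) \<le> trace (D ** M)"
      by (simp add: inner_eq_trace matrix_transpose_mul DT M_def matrix_mul_assoc)
  qed
  have inner_AV: "(X ** D) \<bullet> (A ** V) = trace (A ** V ** D ** transpose X)" for X :: "real^'k^'n"
    using trace_mul_sym[of "transpose (X ** D)" "A ** V"]
    by (simp add: inner_eq_trace matrix_transpose_mul DT matrix_mul_assoc)
  have left: "psd (A ** V ** D ** transpose U)"
  proof (rule psd_if_trace_maximal)
    fix R :: "real^'n^'n" assume "R \<in> stiefel"
    then have "(transpose R ** U ** D) \<bullet> (A ** V) \<le> (U ** D) \<bullet> (A ** V)"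
      by (intro max V stiefel_mult U transpose_in_stiefel)
    then show "trace (A ** V ** D ** transpose U ** R) \<le> trace (A ** V ** D ** transpose U)"
      by (simp add: inner_AV matrix_transpose_mul matrix_mul_assoc)
  qed
  have UU: "transpose U ** U = mat 1" and VV: "V ** transpose V = mat 1"
    using U transpose_in_stiefel[OF V] by (simp_all add: stiefel_def)
  have DM: "D ** M = transpose M ** D"
    using right by (metis psd_def matrix_transpose_mul DT)
  \<comment> \<open>Symmetry of the n x n matrix A V D U^T gives an identity for all of A V, not
    just for its projection M. Once M is known to be diagonal, cancelling the positive entries of D
    yields A V = U diag(s).\<close>
  have "A ** V ** D = A ** V ** D ** transpose U ** U"
    by (metis UU matrix_mul_assoc matrix_mul_rid)
  also have "\<dots> = transpose (A ** V ** D ** transpose U) ** U"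
    using left by (simp add: psd_def)
  also have "\<dots> = U ** D ** transpose M"
    by (simp add: matrix_transpose_mul DT M_def matrix_mul_assoc)
  finally have AVD: "A ** V ** D = U ** D ** transpose M" .
  have MD: "M ** D = D ** transpose M"
  proof -
    have "M ** D = transpose U ** (A ** V ** D)"
      by (simp add: M_def matrix_mul_assoc)
    also have "\<dots> = D ** transpose M"
      by (simp add: AVD matrix_mul_assoc UU)
    finally show ?thesis .
  qed
  have off: "M $ i $ j = 0" if "i \<noteq> j" for i j
  proof -
    have 1: "d $ i * M $ i $ j = M $ j $ i * d $ j"
      using arg_cong[OF DM, of "\<lambda>X. X $ i $ j"]
      by (simp add: D_def mult_diag_matrix diag_matrix_mult transpose_def)
    have 2: "M $ i $ j * d $ j = d $ i * M $ j $ i"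
      using arg_cong[OF MD, of "\<lambda>X. X $ i $ j"]
      by (simp add: D_def mult_diag_matrix diag_matrix_mult transpose_def)
    \<comment> \<open>Eliminate the entry (j, i) of M between the two identities.\<close>
    from 1 2 have "((d $ j)\<^sup>2 - (d $ i)\<^sup>2) * M $ i $ j = 0"
      by algebra
    moreover have "(d $ j)\<^sup>2 \<noteq> (d $ i)\<^sup>2"
      using d_inj[of i j] that d_pos[of i] d_pos[of j] by (auto simp: power2_eq_iff)
    ultimately show ?thesis by simp
  qed
  define s :: "real^'k" where "s = (\<chi> j. M $ j $ j)"
  have M: "M = diag_matrix s"
    using off by (auto simp: diag_matrix_def s_def vec_eq_iff)
  have "s $ j \<ge> 0" for j
  proof -
    have "axis j 1 \<bullet> ((D ** M) *v axis j 1) \<ge> 0"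
      using right by (simp add: psd_def)
    then have "d $ j * s $ j \<ge> 0"
      by (simp add: matrix_vector_mult_basis inner_axis' column_def D_def diag_matrix_mult s_def)
    then show ?thesis
      using d_pos[of j] by (simp add: zero_le_mult_iff)
  qed
  moreover have "A ** V = U ** diag_matrix s"
  proof -
    have "(A ** V) $ i $ j * d $ j = (U ** diag_matrix s) $ i $ j * d $ j" for i j
      using arg_cong[OF AVD, of "\<lambda>X. X $ i $ j"]
      by (simp add: M D_def mult_diag_matrix)
    then show ?thesis
      using d_pos by (metis less_irrefl mult_right_cancel vec_eq_iff)
  qed
  then have "A = U ** diag_matrix s ** transpose V"
    by (metis VV matrix_mul_assoc matrix_mul_rid)
  ultimately show ?thesis
    using U V by (auto simp: thin_svd_def)
qed

section \<open>Norm estimates for products with Stiefel matrices\<close>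

lemma norm_stiefel_mult: "X \<in> stiefel \<Longrightarrow> norm (X ** A) = norm A"
  for X :: "real^'m^'n" and A :: "real^'k^'m"
  by (simp add: norm_eq_sqrt_inner inner_mult_left matrix_mul_assoc stiefel_def)

lemma norm_mult_transpose_stiefel: "V \<in> stiefel \<Longrightarrow> norm (A ** transpose V) = norm A"
  for A :: "real^'m^'k" and V :: "real^'m^'n"
  by (metis matrix_transpose_mul norm_stiefel_mult norm_transpose transpose_transpose)

lemma norm_mult_orthogonal: "Q \<in> stiefel \<Longrightarrow> norm (A ** Q) = norm A"
  for A :: "real^'k^'n" and Q :: "real^'k^'k"
  by (metis norm_mult_transpose_stiefel transpose_in_stiefel transpose_transpose)

text \<open>Each entry of the product pairs a row of A with a column of B, so Cauchy-Schwarz applies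
  entry by entry.\<close>

lemma norm_matrix_mult_le: "norm (A ** B) \<le> norm A * norm B"
  for A :: "real^'m^'n" and B :: "real^'k^'m"
proof (rule power2_le_imp_le)
  have norm_rows: "(norm C)\<^sup>2 = (\<Sum>i\<in>UNIV. (norm (C $ i))\<^sup>2)" for C :: "real^'c^'d"
    by (simp add: power2_norm_eq_inner inner_vec_def)
  have "(norm (A ** B))\<^sup>2 = (\<Sum>i\<in>UNIV. \<Sum>j\<in>UNIV. (A $ i \<bullet> transpose B $ j)\<^sup>2)"
    unfolding power2_norm_eq_inner
    by (simp add: inner_vec_def matrix_matrix_mult_def transpose_def power2_eq_square)
  also have "\<dots> \<le> (\<Sum>i\<in>UNIV. \<Sum>j\<in>UNIV. (norm (A $ i))\<^sup>2 * (norm (transpose B $ j))\<^sup>2)"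
    by (intro sum_mono) (simp add: power2_norm_eq_inner Cauchy_Schwarz_ineq)
  also have "\<dots> = (norm A * norm B)\<^sup>2"
    by (simp add: power_mult_distrib norm_rows[of A] norm_transpose[symmetric, of B]
        norm_rows[of "transpose B"] sum_product)
  finally show "(norm (A ** B))\<^sup>2 \<le> (norm A * norm B)\<^sup>2" .
qed simp

lemma abs_entry_le_1_stiefel:
  fixes X Y :: "real^'k^'n"
  assumes "X \<in> stiefel" "Y \<in> stiefel"
  shows "\<bar>(transpose X ** Y) $ i $ j\<bar> \<le> 1"
proof -
  have entry: "(transpose A ** B) $ a $ b = column a A \<bullet> column b B" for A B :: "real^'k^'n" and a b
    by (simp add: matrix_matrix_mult_def transpose_def column_def inner_vec_def)
  have "norm (column a A) = 1" if "A \<in> stiefel" for A :: "real^'k^'n" and a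
    using that entry[of A A a a] by (simp add: stiefel_def norm_eq_sqrt_inner mat_def)
  then show ?thesis
    using Cauchy_Schwarz_ineq2[of "column i X" "column j Y"] assms by (simp add: entry)
qed

section \<open>Uniqueness of singular values, and canonical angles\<close>

lemma thin_svd_gram:
  assumes "thin_svd B U s V"
  shows "transpose B ** B ** V = V ** diag_matrix s ** diag_matrix s"
proof -
  have U: "transpose U ** U = mat 1" and V: "transpose V ** V = mat 1"
    and B: "B = U ** diag_matrix s ** transpose V"
    using assms by (simp_all add: thin_svd_def stiefel_def)
  have BV: "B ** V = U ** diag_matrix s"
    unfolding B by (metis V matrix_mul_assoc matrix_mul_rid)
  have "transpose B ** U = V ** diag_matrix s"
    unfolding B matrix_transpose_mul by (simp add: matrix_mul_assoc)
      (metis U matrix_mul_assoc matrix_mul_rid)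
  then show ?thesis
    by (metis BV matrix_mul_assoc)
qed

text \<open>The orthogonal matrix G = V'^T V intertwines the diagonal matrices of squared values, so
  a nonzero entry G_ij forces s_j = s'_i, and no column of G vanishes. Only the sets of values are
  compared, and these determine \<open>sigma_min\<close>.\<close>

lemma thin_svd_unique:
  assumes "thin_svd B U s V" "thin_svd B U' s' V'"
  shows "\<exists>i. s $ j = s' $ i"
proof -
  define G where "G = transpose V' ** V"
  have V: "V \<in> stiefel" and V': "V' \<in> stiefel" "transpose V' ** V' = mat 1" "V' ** transpose V' = mat 1"
    using assms transpose_in_stiefel[of V'] by (simp_all add: thin_svd_def stiefel_def)
  have "transpose B ** B = V' ** diag_matrix s' ** diag_matrix s' ** transpose V'"
    by (metis V'(3) assms(2) matrix_mul_assoc matrix_mul_rid thin_svd_gram)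
  then have "V ** diag_matrix s ** diag_matrix s = V' ** (diag_matrix s' ** (diag_matrix s' ** G))"
    using thin_svd_gram[OF assms(1)] by (simp add: G_def matrix_mul_assoc)
  then have "G ** diag_matrix s ** diag_matrix s = diag_matrix s' ** (diag_matrix s' ** G)"
    by (metis G_def V'(2) matrix_mul_assoc matrix_mul_lid)
  then have eq: "G $ i $ j * (s $ j)\<^sup>2 = (s' $ i)\<^sup>2 * G $ i $ j" for i
    by (auto simp: mult_diag_matrix diag_matrix_mult power2_eq_square mult.assoc
        dest: arg_cong[where f = "\<lambda>X. X $ i $ j"])
  have "G \<in> stiefel"
    unfolding G_def by (intro stiefel_mult transpose_in_stiefel V V'(1))
  then have "(transpose G ** G) $ j $ j = 1"
    by (simp add: stiefel_def mat_def)
  then have "(\<Sum>i\<in>UNIV. G $ i $ j * G $ i $ j) \<noteq> 0"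
    by (simp add: matrix_matrix_mult_def transpose_def)
  then obtain i where "G $ i $ j \<noteq> 0"
    by (metis (mono_tags, lifting) mult_zero_left sum.neutral)
  with eq[of i] have "(s $ j)\<^sup>2 = (s' $ i)\<^sup>2"
    by simp
  moreover have "s $ j \<ge> 0" "s' $ i \<ge> 0"
    using assms by (simp_all add: thin_svd_def)
  ultimately show ?thesis
    by (auto simp: power2_eq_iff_nonneg)
qed

lemma thin_svd_sing_vals:
  assumes "thin_svd B U s V"
  obtains U' V' where "thin_svd B U' (sing_vals B) V'"
  using assms someI_ex[of "\<lambda>s. \<exists>U V. thin_svd B U s V"] unfolding sing_vals_def by blast

lemma sigma_min_nonneg: "thin_svd B U s V \<Longrightarrow> 0 \<le> sigma_min B"
  by (erule thin_svd_sing_vals) (simp add: sigma_min_def thin_svd_def)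

lemma sigma_min_le: "thin_svd B U s V \<Longrightarrow> sigma_min B \<le> s $ j"
  by (metis (mono_tags) Min_le finite finite_imageI rangeI sigma_min_def thin_svd_sing_vals thin_svd_unique)

text \<open>Each angle contributes 1 minus its squared cosine, and the squared cosines, being
  squared singular values, add up to the squared Frobenius norm of X^T Y.\<close>

lemma norm_sin_Theta:
  fixes X Y :: "real^'k^'n"
  assumes X: "X \<in> stiefel" and Y: "Y \<in> stiefel"
  shows "(norm (sin_Theta X Y))\<^sup>2 = CARD('k) - (norm (transpose X ** Y))\<^sup>2"
proof -
  define c where "c = sing_vals (transpose X ** Y)"
  obtain U V where svd: "thin_svd (transpose X ** Y) U c V"
    unfolding c_def using thin_svd_exists[of "transpose X ** Y"] thin_svd_sing_vals by blast
  then have U: "U \<in> stiefel" and V: "V \<in> stiefel" and c_nonneg: "\<And>j. c $ j \<ge> 0"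
    and XY: "transpose X ** Y = U ** diag_matrix c ** transpose V"
    by (simp_all add: thin_svd_def)
  \<comment> \<open>The singular values are diagonal entries of (X U)^T (Y V) with X U and Y V in
    \<open>stiefel\<close>. Hence they are at most 1 in absolute value, where cos (arccos c) = c is
    valid.\<close>
  have "transpose (X ** U) ** (Y ** V) = transpose U ** (transpose X ** Y) ** V"
    by (simp add: matrix_transpose_mul matrix_mul_assoc)
  also have "\<dots> = (transpose U ** U) ** diag_matrix c ** (transpose V ** V)"
    unfolding XY by (simp add: matrix_mul_assoc)
  also have "\<dots> = diag_matrix c"
    using U V by (simp add: stiefel_def)
  finally have "\<bar>diag_matrix c $ j $ j\<bar> \<le> 1" for j
    using abs_entry_le_1_stiefel[OF stiefel_mult[OF X U] stiefel_mult[OF Y V]] by metis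
  then have "(sin (arccos (c $ j)))\<^sup>2 = 1 - (c $ j)\<^sup>2" for j
    by (simp add: diag_matrix_def sin_squared_eq cos_arccos_abs)
  then have "(norm (sin_Theta X Y))\<^sup>2 = (\<Sum>j\<in>UNIV. 1 - (c $ j)\<^sup>2)"
    by (simp add: sin_Theta_def norm_diag_matrix canonical_angles_def c_def)
  also have "\<dots> = CARD('k) - (norm (diag_matrix c))\<^sup>2"
    by (simp add: sum_subtractf norm_diag_matrix)
  also have "norm (diag_matrix c) = norm (transpose X ** Y)"
    unfolding XY by (simp add: norm_mult_transpose_stiefel norm_stiefel_mult U V)
  finally show ?thesis .
qed

section \<open>Polar factors and the gain of one step\<close>

lemma inner_thin_svd:
  assumes "thin_svd B U s V"
  shows "X \<bullet> B = (\<Sum>j\<in>UNIV. s $ j * (transpose U ** X ** V) $ j $ j)"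
proof -
  have "X \<bullet> B = (X ** V) \<bullet> (U ** diag_matrix s)"
    using assms inner_mult_right[of X "U ** diag_matrix s" "transpose V"] by (simp add: thin_svd_def)
  also have "\<dots> = (transpose U ** X ** V) \<bullet> diag_matrix s"
    by (simp add: inner_mult_left matrix_mul_assoc)
  finally have "X \<bullet> B = (transpose U ** X ** V) \<bullet> diag_matrix s" .
  then show ?thesis
    by (simp add: inner_vec_def diag_matrix_def if_distrib mult.commute cong: if_cong)
qed

text \<open>For the polar factor itself the matrix U^T X V is the identity, so
  \<open>inner_thin_svd\<close> gives the sum of the s_j.\<close>

lemma polar_gap:
  assumes svd: "thin_svd B U s V"
  shows "(U ** transpose V) \<bullet> B - X \<bullet> B = (\<Sum>j\<in>UNIV. s $ j * (1 - (transpose U ** X ** V) $ j $ j))"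
proof -
  have "transpose U ** (U ** transpose V) ** V = (transpose U ** U) ** (transpose V ** V)"
    by (simp add: matrix_mul_assoc)
  also have "\<dots> = mat 1"
    using svd by (simp add: thin_svd_def stiefel_def)
  finally show ?thesis
    by (simp add: inner_thin_svd[OF svd] right_diff_distrib sum_subtractf mat_def)
qed

lemma polar_maximal:
  assumes svd: "thin_svd B U s V" and X: "X \<in> stiefel"
  shows "X \<bullet> B \<le> (U ** transpose V) \<bullet> B"
proof -
  have "\<bar>(transpose U ** X ** V) $ j $ j\<bar> \<le> 1" for j
    using abs_entry_le_1_stiefel[of U "X ** V"] stiefel_mult[OF X, of V] svd
    by (simp add: thin_svd_def matrix_mul_assoc)
  then have "(\<Sum>j\<in>UNIV. s $ j * (1 - (transpose U ** X ** V) $ j $ j)) \<ge> 0"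
    using svd by (intro sum_nonneg mult_nonneg_nonneg) (auto simp: thin_svd_def abs_le_iff)
  then show ?thesis
    using polar_gap[OF svd, of X] by simp
qed

lemma sigma_min_mult_le_polar_gap:
  fixes X :: "real^'k^'n"
  assumes svd: "thin_svd B U s V" and X: "X \<in> stiefel"
  shows "sigma_min B * (CARD('k) - (norm (transpose X ** (U ** transpose V)))\<^sup>2)
    \<le> 2 * ((U ** transpose V) \<bullet> B - X \<bullet> B)"
proof -
  define W where "W = transpose U ** X ** V"
  have U: "U \<in> stiefel" and V: "V \<in> stiefel"
    using svd by (simp_all add: thin_svd_def)
  have W_le: "\<bar>W $ j $ j\<bar> \<le> 1" for j
    using abs_entry_le_1_stiefel[OF U stiefel_mult[OF X V]]
    by (simp add: W_def matrix_mul_assoc)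
  have "norm (transpose X ** (U ** transpose V)) = norm (transpose (transpose U ** X))"
    by (simp add: matrix_mul_assoc norm_mult_transpose_stiefel V matrix_transpose_mul)
  also have "\<dots> = norm W"
    by (simp add: W_def norm_transpose norm_mult_orthogonal V)
  finally have norm_W: "norm (transpose X ** (U ** transpose V)) = norm W" .
  have "(\<Sum>j\<in>UNIV. (W $ j $ j)\<^sup>2) \<le> (\<Sum>i\<in>UNIV. \<Sum>j\<in>UNIV. (W $ i $ j)\<^sup>2)"
    by (intro sum_mono member_le_sum) auto
  also have "\<dots> = (norm W)\<^sup>2"
    unfolding power2_norm_eq_inner by (simp add: inner_vec_def power2_eq_square)
  finally have "sigma_min B * (CARD('k) - (norm W)\<^sup>2)
      \<le> sigma_min B * (\<Sum>j\<in>UNIV. 1 - (W $ j $ j)\<^sup>2)"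
    using sigma_min_nonneg[OF svd] by (intro mult_left_mono) (simp_all add: sum_subtractf)
  also have "\<dots> = (\<Sum>j\<in>UNIV. sigma_min B * (1 - (W $ j $ j)\<^sup>2))"
    by (rule sum_distrib_left)
  also have "\<dots> \<le> (\<Sum>j\<in>UNIV. s $ j * (2 * (1 - W $ j $ j)))"
  proof (intro sum_mono mult_mono sigma_min_le[OF svd])
    fix j
    \<comment> \<open>For w = W_jj, expanding (1 - w)^2 >= 0 gives 1 - w^2 <= 2 (1 - w); this is the
      source of the factor 2.\<close>
    have "0 \<le> (1 - W $ j $ j)\<^sup>2" by simp
    then show "1 - (W $ j $ j)\<^sup>2 \<le> 2 * (1 - W $ j $ j)"
      by (simp add: power2_eq_square algebra_simps)
  qed (use svd W_le in \<open>auto simp: thin_svd_def abs_square_le_1\<close>)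
  also have "\<dots> = 2 * ((U ** transpose V) \<bullet> B - X \<bullet> B)"
    by (simp add: polar_gap[OF svd] W_def sum_distrib_left mult.left_commute)
  finally show ?thesis
    unfolding norm_W .
qed

text \<open>The residual factors as (Y - X X^T Y) M. The first factor is measured by Pythagoras, and
  M has the norm of B because Y has orthonormal columns.\<close>

lemma norm_residual_le:
  fixes X Y :: "real^'k^'n" and M :: "real^'k^'k"
  assumes X: "X \<in> stiefel" and Y: "Y \<in> stiefel" and B: "B = Y ** M"
  shows "(norm (B - X ** (transpose X ** B)))\<^sup>2
    \<le> (CARD('k) - (norm (transpose X ** Y))\<^sup>2) * (norm B)\<^sup>2"
proof -
  define Z where "Z = transpose X ** Y"
  have "B - X ** (transpose X ** B) = (Y - X ** Z) ** M"
    by (simp add: B Z_def matrix_mult.diff_left matrix_mul_assoc)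
  then have "(norm (B - X ** (transpose X ** B)))\<^sup>2 \<le> (norm (Y - X ** Z))\<^sup>2 * (norm M)\<^sup>2"
    by (metis norm_ge_zero norm_matrix_mult_le power_mono power_mult_distrib)
  also have "(norm (Y - X ** Z))\<^sup>2 = (norm Y)\<^sup>2 - 2 * (Y \<bullet> (X ** Z)) + (norm (X ** Z))\<^sup>2"
    by (simp add: power2_norm_eq_inner inner_diff inner_commute)
  also have "\<dots> = CARD('k) - (norm Z)\<^sup>2"
    by (simp add: norm_stiefel[OF Y] norm_stiefel_mult[OF X] inner_mult_left Z_def [symmetric]
        dot_square_norm)
  also have "norm M = norm B"
    by (simp add: B norm_stiefel_mult[OF Y])
  finally show ?thesis
    by (simp add: Z_def)
qed

text \<open>Rotating P from the right gives semidefiniteness of P^T B, and rotating it from the left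
  gives symmetry of B P^T. The two symmetries turn B = B P^T P into P B^T P and then into P P^T
  B.\<close>

lemma critical_if_inner_maximal:
  fixes P B :: "real^'k^'n"
  assumes P: "P \<in> stiefel" and max: "\<And>X. X \<in> stiefel \<Longrightarrow> X \<bullet> B \<le> P \<bullet> B"
  shows "B = P ** (transpose P ** B)" and "psd (transpose P ** B)"
proof -
  show psd: "psd (transpose P ** B)"
  proof (rule psd_if_trace_maximal)
    fix R :: "real^'k^'k" assume "R \<in> stiefel"
    then have "(P ** transpose R) \<bullet> B \<le> P \<bullet> B"
      by (intro max stiefel_mult P transpose_in_stiefel)
    then show "trace (transpose P ** B ** R) \<le> trace (transpose P ** B)"
      using trace_mul_sym[of R "transpose P ** B"]
      by (simp add: inner_eq_trace matrix_transpose_mul matrix_mul_assoc)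
  qed
  have "psd (B ** transpose P)"
  proof (rule psd_if_trace_maximal)
    fix R :: "real^'n^'n" assume "R \<in> stiefel"
    then have "(transpose R ** P) \<bullet> B \<le> P \<bullet> B"
      by (intro max stiefel_mult P transpose_in_stiefel)
    then show "trace (B ** transpose P ** R) \<le> trace (B ** transpose P)"
      using trace_mul_sym[of B "transpose P ** R"] trace_mul_sym[of B "transpose P"]
      by (simp add: inner_eq_trace matrix_transpose_mul matrix_mul_assoc)
  qed
  then have BP: "B ** transpose P = P ** transpose B"
    by (simp add: psd_def matrix_transpose_mul)
  have "B = B ** (transpose P ** P)"
    using P by (simp add: stiefel_def)
  also have "\<dots> = P ** (transpose B ** P)"
    by (simp add: matrix_mul_assoc BP)
  also have "transpose B ** P = transpose P ** B"
    using psd by (simp add: psd_def matrix_transpose_mul)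
  finally show "B = P ** (transpose P ** B)" .
qed

section \<open>Convergence of the iteration\<close>

theorem theorem3p2:
  fixes f :: "real^'k^'n \<Rightarrow> real"
    and N :: "real^'k^'k \<Rightarrow> real"
    and \<delta> \<omega> :: real
    and PP :: "(real^'k^'n) set"
    and P :: "nat \<Rightarrow> real^'k^'n"
  assumes "CARD('k) \<le> CARD('n)"
    and "matrix_norm N" and "\<delta> > 0"
    and "f differentiable_on stiefel_nbhd N \<delta>"
    and "PP \<subseteq> stiefel"
    and "npdo_ansatz f PP \<omega>"
    and "npdo_scf f PP \<omega> P"
  shows
    "(incseq (\<lambda>i. f (P i)) \<and> convergent (\<lambda>i. f (P i))) \<and>
     (continuous_on (stiefel :: (real^'k^'n) set) (euclid_grad f) \<longrightarrow>
       (\<forall>Pstar. accumulation_point P Pstar \<longrightarrow>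
         euclid_grad f Pstar = Pstar ** (transpose Pstar ** euclid_grad f Pstar) \<and>
         psd (transpose Pstar ** euclid_grad f Pstar))) \<and>
     summable (\<lambda>i. sigma_min (euclid_grad f (P (Suc i)))
         * (norm (sin_Theta (P (Suc (Suc i))) (P (Suc i))))\<^sup>2) \<and>
     summable (\<lambda>i. sigma_min (euclid_grad f (P (Suc i)))
         * ((norm (euclid_grad f (P (Suc i))
                   - P (Suc i) ** (transpose (P (Suc i)) ** euclid_grad f (P (Suc i)))))\<^sup>2
            / (norm (euclid_grad f (P (Suc i))))\<^sup>2))"
proof -
  define H where "H i = euclid_grad f (P i)" for i
  define e where "e i = f (P (Suc i)) - f (P i)" for i
  have \<omega>: "\<omega> > 0"
    using assms(6) by (simp add: npdo_ansatz_def)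
  have "P i \<in> PP" for i
    using assms(7) by (cases i) (auto simp: npdo_scf_def)
  then have P: "P i \<in> stiefel" for i
    using assms(5) by blast
  \<comment> \<open>The first conjunct ranges over all X in \<open>stiefel\<close>: a fixed X
    survives the passage to the limit, and X = \<open>P i\<close> shows that the increment
    \<open>e i\<close> is nonnegative.\<close>
  have step: "(\<forall>X\<in>stiefel. \<omega> * (X \<bullet> H i - P i \<bullet> H i) \<le> e i)
      \<and> 0 \<le> sigma_min (H i)
      \<and> \<omega> * (sigma_min (H i) * (norm (sin_Theta (P (Suc i)) (P i)))\<^sup>2) \<le> 2 * e i
      \<and> (norm (H i - P i ** (transpose (P i) ** H i)))\<^sup>2 / (norm (H i))\<^sup>2
          \<le> (norm (sin_Theta (P (Suc i)) (P i)))\<^sup>2" for i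
  proof -
    obtain U s V Q where svd: "thin_svd (H i) U s V" and Q: "Q \<in> stiefel"
      and P_Suc: "P (Suc i) = U ** transpose V ** Q"
      and incr: "f (P (Suc i)) \<ge> f (P i)
        + \<omega> * (trace (transpose (U ** transpose V) ** H i) - trace (transpose (P i) ** H i))"
      using assms(7) unfolding npdo_scf_def H_def by metis
    have UV: "U \<in> stiefel" "V \<in> stiefel" and Hi: "H i = U ** diag_matrix s ** transpose V"
      using svd by (simp_all add: thin_svd_def)
    define Y where "Y = U ** transpose V"
    have Y: "Y \<in> stiefel"
      unfolding Y_def by (intro stiefel_mult transpose_in_stiefel UV)
    have gap: "\<omega> * (Y \<bullet> H i - P i \<bullet> H i) \<le> e i"
      using incr by (simp add: e_def inner_eq_trace Y_def)
    have "\<omega> * (X \<bullet> H i - P i \<bullet> H i) \<le> e i" if "X \<in> stiefel" for X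
    proof -
      have "\<omega> * (X \<bullet> H i - P i \<bullet> H i) \<le> \<omega> * (Y \<bullet> H i - P i \<bullet> H i)"
        using \<omega> polar_maximal[OF svd that] by (simp add: Y_def)
      with gap show ?thesis by simp
    qed
    \<comment> \<open>P (i+1) = Y Q spans the same column space as Y, and the orthogonal factor Q
      does not affect the norm.\<close>
    moreover have sin: "(norm (sin_Theta (P (Suc i)) (P i)))\<^sup>2 = CARD('k) - (norm (transpose (P i) ** Y))\<^sup>2"
    proof -
      have "norm (transpose (P (Suc i)) ** P i) = norm (transpose (P i) ** Y ** Q)"
        by (metis matrix_mul_assoc matrix_transpose_mul norm_transpose P_Suc transpose_transpose Y_def)
      then show ?thesis
        by (simp add: norm_sin_Theta P norm_mult_orthogonal Q)
    qed
    moreover have "\<omega> * (sigma_min (H i) * (CARD('k) - (norm (transpose (P i) ** Y))\<^sup>2)) \<le> 2 * e i"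
    proof -
      have "\<omega> * (sigma_min (H i) * (CARD('k) - (norm (transpose (P i) ** Y))\<^sup>2))
          \<le> \<omega> * (2 * (Y \<bullet> H i - P i \<bullet> H i))"
        using \<omega> sigma_min_mult_le_polar_gap[OF svd P[of i]] by (simp add: Y_def)
      also have "\<dots> = 2 * (\<omega> * (Y \<bullet> H i - P i \<bullet> H i))" by simp
      finally show ?thesis
        using gap by linarith
    qed
    moreover have "(norm (H i - P i ** (transpose (P i) ** H i)))\<^sup>2 / (norm (H i))\<^sup>2
        \<le> (norm (sin_Theta (P (Suc i)) (P i)))\<^sup>2"
    proof -
      \<comment> \<open>Polar decomposition of the gradient, with symmetric factor V diag(s)
        V^T.\<close>
      have "H i = Y ** (V ** diag_matrix s ** transpose V)"
      proof -
        have "Y ** (V ** diag_matrix s ** transpose V)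
            = U ** (transpose V ** V) ** diag_matrix s ** transpose V"
          by (simp add: Y_def matrix_mul_assoc)
        then show ?thesis
          using UV by (simp add: Hi stiefel_def)
      qed
      \<comment> \<open>If the gradient is zero, the quotient is 0 by the convention for division by
        zero.\<close>
      from norm_residual_le[OF P[of i] Y this] show ?thesis
        by (cases "H i = 0") (simp_all add: sin [symmetric] divide_le_eq)
    qed
    ultimately show ?thesis
      using sigma_min_nonneg[OF svd] by simp
  qed
  have e_nonneg: "e i \<ge> 0" for i
    using step[of i] P[of i] by fastforce
  have inc: "incseq (\<lambda>i. f (P i))"
    using e_nonneg by (intro incseq_SucI) (simp add: e_def)
  \<comment> \<open>A norm vanishes at 0, so the Stiefel manifold lies inside the neighborhood on
    which f is differentiable.\<close>
  have "N 0 = 0"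
    using assms(2) unfolding matrix_norm_def by blast
  then have "stiefel \<subseteq> stiefel_nbhd N \<delta>"
    using assms(3) by (auto simp: stiefel_def stiefel_nbhd_def)
  then have "continuous_on stiefel f"
    using assms(4) continuous_on_subset differentiable_imp_continuous_on by blast
  then have "bdd_above (f ` stiefel)"
    by (intro bounded_imp_bdd_above compact_imp_bounded compact_continuous_image compact_stiefel)
  then obtain C where "\<And>i. f (P i) \<le> C"
    using P by (auto simp: bdd_above_def)
  then obtain L where L: "(\<lambda>i. f (P i)) \<longlonglongrightarrow> L"
    using incseq_convergent[OF inc] by blast
  have "summable e"
    unfolding e_def using L by (rule telescope_summable)
  then have e_lim: "e \<longlonglongrightarrow> 0"
    by (rule summable_LIMSEQ_zero)
  have critical: "euclid_grad f Q = Q ** (transpose Q ** euclid_grad f Q)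
      \<and> psd (transpose Q ** euclid_grad f Q)"
    if cont: "continuous_on stiefel (euclid_grad f)" and acc: "accumulation_point P Q" for Q
  proof -
    obtain r where r: "strict_mono r" "(P \<circ> r) \<longlonglongrightarrow> Q"
      using acc by (auto simp: accumulation_point_def)
    have Q: "Q \<in> stiefel"
      using closed_sequentially[OF compact_imp_closed[OF compact_stiefel], of "P \<circ> r" Q] r(2) P by auto
    \<comment> \<open>Here continuity of the gradient enters: differentiability of f alone does not
      let gradients pass to the limit.\<close>
    have "(\<lambda>i. H (r i)) \<longlonglongrightarrow> euclid_grad f Q"
      using continuous_on_tendsto_compose[OF cont r(2) Q] P by (simp add: H_def)
    moreover have "(\<lambda>i. P (r i)) \<longlonglongrightarrow> Q"
      using r(2) by (simp add: o_def)
    ultimately have lim: "(\<lambda>i. \<omega> * (X \<bullet> H (r i) - P (r i) \<bullet> H (r i)))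
        \<longlonglongrightarrow> \<omega> * (X \<bullet> euclid_grad f Q - Q \<bullet> euclid_grad f Q)" for X
      by (intro tendsto_intros)
    have "X \<bullet> euclid_grad f Q \<le> Q \<bullet> euclid_grad f Q" if "X \<in> stiefel" for X
    proof -
      have "(\<lambda>i. e (r i)) \<longlonglongrightarrow> 0"
        using LIMSEQ_subseq_LIMSEQ[OF e_lim r(1)] by (simp add: o_def)
      then have "\<omega> * (X \<bullet> euclid_grad f Q - Q \<bullet> euclid_grad f Q) \<le> 0"
        using LIMSEQ_le[OF lim] step that by blast
      then show ?thesis
        using \<omega> by (simp add: mult_le_0_iff)
    qed
    then show ?thesis
      using critical_if_inner_maximal[OF Q] by blast
  qed
  define a where "a i = sigma_min (H i) * (norm (sin_Theta (P (Suc i)) (P i)))\<^sup>2" for i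
  have "summable a"
  proof (rule summable_comparison_test')
    show "summable (\<lambda>i. 2 / \<omega> * e i)"
      using \<open>summable e\<close> by (rule summable_mult)
    fix i :: nat
    show "norm (a i) \<le> 2 / \<omega> * e i"
      using step[of i] \<omega> by (simp add: a_def field_simps)
  qed
  \<comment> \<open>The series of the statement start at index 1, hence the shift by
    \<open>Suc\<close>.\<close>
  then have sum1: "summable (\<lambda>i. a (Suc i))"
    by (simp add: summable_Suc_iff)
  have "summable (\<lambda>i. sigma_min (H (Suc i)) * ((norm (H (Suc i)
      - P (Suc i) ** (transpose (P (Suc i)) ** H (Suc i))))\<^sup>2 / (norm (H (Suc i)))\<^sup>2))"
  proof (rule summable_comparison_test'[OF sum1])
    fix i :: nat
    show "norm (sigma_min (H (Suc i)) * ((norm (H (Suc i)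
        - P (Suc i) ** (transpose (P (Suc i)) ** H (Suc i))))\<^sup>2 / (norm (H (Suc i)))\<^sup>2)) \<le> a (Suc i)"
      using step[of "Suc i"]
      by (simp add: a_def abs_mult mult_left_mono del: times_divide_eq_right)
  qed
  with sum1 inc L critical show ?thesis
    unfolding a_def H_def convergent_def by blast
qed

end
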